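(* Fix $p\in(0,1)$ and let $G_{n,p}$ be the Erdős–Rényi random graph on $n$ vertices (each possible edge present independently with probability $p$). Let $x_1\ge\cdots\ge x_n$ be the roots of the matching polynomial $m(G_{n,p},x)$, $\lambda_i=x_i/\sqrt{np}$, and $F_n(x)=\frac1n|\{i:\lambda_i\le x\}|$. Then for every positive integer $k$, $$\lim_{n\to\infty}\int_{\mathbb{R}}x^k\,dF_n(x)=\int_{\mathbb{R}}x^k\,dF_{sc}(x)\quad\text{almost surely},$$ where $F_{sc}$ is the standard semicircle distribution with density $\rho_{sc}(x)=\frac{1}{2\pi}\sqrt{4-x^2}$ on $|x|\le 2$ (and $0$ elsewhere).
   Context: For a finite simple graph $G$ of order $n$, let $m_k(G)$ be the number of $k$-matchings of $G$, with $m_0(G)=1$. The matching polynomial is $m(G,x)=\sum_{k=0}^{\lfloor n/2\rfloor}(-1)^k m_k(G)x^{n-2k}$; all its roots are real. Note $\int x^k dF_n(x)=\frac1n\sum_i\lambda_i^k$. *)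

theory Defs
  imports "HOL-Probability.Probability" "HOL-Computational_Algebra.Computational_Algebra"
begin

text \<open>A finite simple graph is given by a finite vertex set \<open>V\<close> and an edge set
  \<open>E \<subseteq> all_edges V\<close>.\<close>

definition all_edges :: "'a set \<Rightarrow> 'a set set" where
  "all_edges V = {e. e \<subseteq> V \<and> card e = 2}"

definition k_matchings :: "'a set set \<Rightarrow> nat \<Rightarrow> 'a set set set" where
  "k_matchings E k = {S. S \<subseteq> E \<and> pairwise disjnt S \<and> finite S \<and> card S = k}"

definition matching_poly :: "'a set \<Rightarrow> 'a set set \<Rightarrow> real poly" where
  "matching_poly V E =
     (\<Sum>k\<le>card V div 2. monom ((-1) ^ k * real (card (k_matchings E k))) (card V - 2 * k))"

text \<open>The real roots with multiplicity, in decreasing order. All roots of a matching polynomial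
  are real (Heilmann-Lieb), so that this list has length \<open>card V\<close>; with indices starting at 0,
  its entries are the roots \<open>x\<^sub>1 \<ge> \<dots> \<ge> x\<^sub>n\<close>.\<close>

definition matching_roots :: "'a set \<Rightarrow> 'a set set \<Rightarrow> real list" where
  "matching_roots V E = rev (sorted_list_of_multiset (proots (matching_poly V E)))"

definition matching_edf :: "real \<Rightarrow> 'a set \<Rightarrow> 'a set set \<Rightarrow> real \<Rightarrow> real" where
  "matching_edf p V E x =
     real (card {i. i < card V \<and> matching_roots V E ! i / sqrt (real (card V) * p) \<le> x})
       / real (card V)"

definition erdos_renyi :: "'w measure \<Rightarrow> real \<Rightarrow> 'a set \<Rightarrow> ('w \<Rightarrow> 'a set set) \<Rightarrow> bool" where
  "erdos_renyi M p V G \<longleftrightarrow>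
     prob_space M \<and>
     (\<forall>\<omega>\<in>space M. G \<omega> \<subseteq> all_edges V) \<and>
     prob_space.indep_events M (\<lambda>e. {\<omega>\<in>space M. e \<in> G \<omega>}) (all_edges V) \<and>
     (\<forall>e\<in>all_edges V. measure M {\<omega>\<in>space M. e \<in> G \<omega>} = p)"

definition semicircle_density :: "real \<Rightarrow> real" where
  "semicircle_density x = (if \<bar>x\<bar> \<le> 2 then sqrt (4 - x\<^sup>2) / (2 * pi) else 0)"

definition semicircle_distribution :: "real measure" where
  "semicircle_distribution = density lborel (\<lambda>x. ennreal (semicircle_density x))"

end

theory Submission
  imports Defs "HOL-Probability.Hoeffding"
begin

text \<open>For a vertex \<open>v\<close> let \<open>f\<^sub>v\<close> be the series of \<open>m(G - v, x) / m(G, x)\<close> in \<open>1/x\<close>, normalised to start with 1.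
  As \<open>m' = \<Sum>\<^sub>v m(G - v)\<close>, the \<open>k\<close>-th power sum of the roots is the sum of the \<open>k\<close>-th coefficients of the \<open>f\<^sub>v\<close>,
  and the vertex recurrence of \<open>m\<close> gives \<open>f\<^sub>v = 1 + x\<^sup>-\<^sup>2 (\<Sum>\<^sub>w f\<^sub>w) f\<^sub>v\<close>, where \<open>w\<close> runs over the neighbours of
  \<open>v\<close> and \<open>f\<^sub>w\<close> is taken in \<open>G - v\<close>. If all degrees are close to \<open>d\<close>, this is the Catalan recurrence up to the
  factor \<open>d\<close>, so the coefficient of \<open>x\<^sup>-\<^sup>2\<^sup>m\<close> is close to \<open>d\<^sup>m C\<^sub>m\<close>. By Hoeffding's inequality and the
  Borel-Cantelli lemma, almost surely all degrees of \<open>G\<^sub>n\<^sub>,\<^sub>p\<close> are \<open>n p + o(n)\<close>, and the Catalan numbers are the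
  even moments of the semicircle distribution.\<close>

section \<open>Moments of the semicircle distribution\<close>

lemma semicircle_base:
  "((\<lambda>x. sqrt (4 - x\<^sup>2)) has_integral (2 * pi)) {-2..2::real}"
proof -
  have "((\<lambda>x. sqrt (4 - x\<^sup>2)) has_integral
      ((2 / 2 * sqrt (4 - 2\<^sup>2) + 2 * arcsin (2 / 2)) -
       ((-2) / 2 * sqrt (4 - (-2)\<^sup>2) + 2 * arcsin ((-2) / 2)))) {-2..2::real}"
  \<comment> \<open>The derivative rules for \<open>sqrt\<close> and \<open>arcsin\<close> apply
    only strictly inside the interval; at the endpoints continuity suffices.\<close>
  proof (rule fundamental_theorem_of_calculus_interior)
    show "continuous_on {-2..2} (\<lambda>x::real. x / 2 * sqrt (4 - x\<^sup>2) + 2 * arcsin (x / 2))"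
      by (intro continuous_intros) auto
    fix x :: real assume x: "x \<in> {-2<..<2}"
    have pos: "4 - x\<^sup>2 > 0"
      using x abs_square_less_1[of "x / 2"] by (auto simp: power_divide)
    have s: "sqrt (1 - (x / 2)\<^sup>2) = sqrt (4 - x\<^sup>2) / 2"
    proof -
      have "1 - (x / 2)\<^sup>2 = (4 - x\<^sup>2) / 2\<^sup>2" by (simp add: power_divide field_simps)
      then show ?thesis by (simp only: real_sqrt_divide) simp
    qed
    have sq: "sqrt (4 - x\<^sup>2) * sqrt (4 - x\<^sup>2) = 4 - x\<^sup>2" using pos by simp
    have "((\<lambda>x. x / 2 * sqrt (4 - x\<^sup>2) + 2 * arcsin (x / 2)) has_real_derivative
        sqrt (4 - x\<^sup>2)) (at x)"
      using pos x
      by (auto intro!: derivative_eq_intros simp: s)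
         (use sq in \<open>simp add: field_simps power2_eq_square\<close>)
    then show "((\<lambda>x. x / 2 * sqrt (4 - x\<^sup>2) + 2 * arcsin (x / 2)) has_vector_derivative
        sqrt (4 - x\<^sup>2)) (at x)"
      by (simp add: has_real_derivative_iff_has_vector_derivative)
  qed simp
  then show ?thesis by simp
qed

text \<open>A gauge integral over the support, so that the fundamental theorem of calculus applies
  directly; \<open>integral_semicircle_distribution\<close> identifies it with the moment of the
  measure.\<close>

definition semicircle_moment :: "nat \<Rightarrow> real" where
  "semicircle_moment k = integral {-2..2} (\<lambda>x. x ^ k * sqrt (4 - x\<^sup>2)) / (2 * pi)"

lemma semicircle_integrable: "(\<lambda>x::real. x ^ k * sqrt (4 - x\<^sup>2)) integrable_on {-2..2}"
  by (intro integrable_continuous_real continuous_intros)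

lemma semicircle_moment_0: "semicircle_moment 0 = 1"
  using integral_unique[OF semicircle_base] by (simp add: semicircle_moment_def)

lemma semicircle_moment_odd:
  assumes "odd k"
  shows "semicircle_moment k = 0"
proof -
  let ?f = "\<lambda>x::real. x ^ k * sqrt (4 - x\<^sup>2)"
  have "integral {-2..2} ?f = integral {-2..2} (\<lambda>x. ?f (- x))"
    using Henstock_Kurzweil_Integration.integral_reflect_real[of 2 "-2" ?f] by (simp only: minus_minus)
  also have "\<dots> = - integral {-2..2} ?f"
    using assms by (simp add: power_minus_odd)
  finally show ?thesis by (simp add: semicircle_moment_def)
qed

text \<open>The function \<open>?F\<close>, that is x to the power k+1 times (4 - x^2)^(3/2),
  vanishes at both endpoints, so its derivative integrates to 0. That derivative is a combination of
  the integrands for k and k+2.\<close>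

lemma semicircle_moment_rec:
  "(real k + 4) * semicircle_moment (k + 2) = 4 * (real k + 1) * semicircle_moment k"
proof -
  let ?f = "\<lambda>k (x::real). x ^ k * sqrt (4 - x\<^sup>2)"
  let ?F = "\<lambda>x::real. x ^ (k + 1) * sqrt (4 - x\<^sup>2) ^ 3"
  let ?d = "\<lambda>x. 4 * (real k + 1) * ?f k x - (real k + 4) * ?f (k + 2) x"
  have "(?d has_integral (?F 2 - ?F (-2))) {-2..2}"
  proof (rule fundamental_theorem_of_calculus_interior)
    show "continuous_on {-2..2} ?F" by (intro continuous_intros)
    fix x :: real assume x: "x \<in> {-2<..<2}"
    have pos: "4 - x\<^sup>2 > 0"
      using x abs_square_less_1[of "x / 2"] by (auto simp: power_divide)
    define s where "s = sqrt (4 - x\<^sup>2)"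
    have s: "s > 0" "s\<^sup>2 = 4 - x\<^sup>2" using pos by (auto simp: s_def)
    have ds: "((\<lambda>x. sqrt (4 - x\<^sup>2)) has_real_derivative (- x / s)) (at x)"
      using pos by (auto intro!: derivative_eq_intros simp: s_def field_simps)
    have "(?F has_real_derivative
        (real (k + 1) * x ^ k * s ^ 3 + x ^ (k + 1) * (3 * s\<^sup>2 * (- x / s)))) (at x)"
      by (rule derivative_eq_intros ds refl | simp add: s_def)+
    also have "real (k + 1) * x ^ k * s ^ 3 + x ^ (k + 1) * (3 * s\<^sup>2 * (- x / s)) =
       s * x ^ k * (real (k + 1) * s\<^sup>2 - 3 * x\<^sup>2)"
      using s(1) by (simp add: field_simps power2_eq_square power3_eq_cube)
    also have "\<dots> = ?d x"
      unfolding s(2) s_def[symmetric] by (simp add: power2_eq_square algebra_simps)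
    finally show "(?F has_vector_derivative ?d x) (at x)"
      by (simp add: has_real_derivative_iff_has_vector_derivative)
  qed simp
  then have h0: "(?d has_integral 0) {-2..2}" by simp
  have h1: "(?d has_integral (4 * (real k + 1) * integral {-2..2} (?f k)
      - (real k + 4) * integral {-2..2} (?f (k + 2)))) {-2..2}"
    by (intro has_integral_diff has_integral_mult_right integrable_integral semicircle_integrable)
  have "4 * (real k + 1) * integral {-2..2} (?f k)
      = (real k + 4) * integral {-2..2} (?f (k + 2))"
    using has_integral_unique[OF h0 h1] by linarith
  then show ?thesis by (simp add: semicircle_moment_def field_simps)
qed

lemma integral_semicircle_distribution:
  "(\<integral>x. x ^ k \<partial>semicircle_distribution) = semicircle_moment k"
proof -
  let ?f = "\<lambda>x::real. x ^ k * sqrt (4 - x\<^sup>2)"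
  have ci: "set_integrable lborel {-2..2} ?f"
    by (intro borel_integrable_atLeastAtMost' continuous_intros)
  have nn: "semicircle_density x \<ge> 0" for x
    using abs_le_square_iff[of x 2] by (auto simp: semicircle_density_def)
  have [measurable]: "semicircle_density \<in> borel_measurable borel"
    by (simp add: semicircle_density_def[abs_def])
  have "(\<integral>x. x ^ k \<partial>semicircle_distribution) = (\<integral>x. semicircle_density x * x ^ k \<partial>lborel)"
    unfolding semicircle_distribution_def
    by (subst integral_density) (auto simp: nn)
  also have "\<dots> = (\<integral>x. (indicator {-2..2} x * ?f x) / (2 * pi) \<partial>lborel)"
    by (intro Bochner_Integration.integral_cong refl)
       (auto simp: semicircle_density_def indicator_def abs_le_iff)
  also have "\<dots> = (LINT x:{-2..2}|lborel. ?f x) / (2 * pi)"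
    by (simp add: set_lebesgue_integral_def)
  also have "\<dots> = semicircle_moment k"
    using set_borel_integral_eq_integral(2)[OF ci] by (simp add: semicircle_moment_def)
  finally show ?thesis .
qed

text \<open>The convolution recurrence is the form in which the recursion for the coefficients of
  \<open>walk_fun\<close> is compared with Catalan numbers. The moments need the two-term form
  \<open>catalan_rec\<close> instead.\<close>

fun catalan :: "nat \<Rightarrow> real" where
  "catalan 0 = 1"
| "catalan (Suc n) = (\<Sum>i\<le>n. catalan i * catalan (n - i))"

lemma catalan_nonneg: "catalan n \<ge> 0"
  by (induction n rule: catalan.induct) (auto intro!: sum_nonneg)

text \<open>With \<open>C = 1 + X C\<^sup>2\<close> the series \<open>S = 1 - 2 X C\<close> is a square root of \<open>1 - 4 X\<close>; its differential
  equation \<open>(1 - 4 X) S' = - 2 S\<close> is the two-term recurrence of the semicircle moments.\<close>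

lemma catalan_rec: "(real n + 2) * catalan (Suc n) = (4 * real n + 2) * catalan n"
proof -
  define c where "c = Abs_fps catalan"
  have sq: "fps_nth (c * c) m = catalan (Suc m)" for m
    by (simp add: c_def fps_mult_nth atLeast0AtMost)
  have c: "c = 1 + fps_X * c\<^sup>2"
  proof (rule fps_ext)
    fix n show "fps_nth c n = fps_nth (1 + fps_X * c\<^sup>2) n"
      by (cases n) (simp_all add: power2_eq_square sq, simp_all add: c_def)
  qed
  define s where "s = 1 - 2 * fps_X * c"
  have "s\<^sup>2 = 1 - 4 * fps_X * (c - fps_X * c\<^sup>2)"
    by (simp add: s_def power2_eq_square algebra_simps)
  also have "c - fps_X * c\<^sup>2 = 1" using c by (simp add: algebra_simps)
  finally have s2: "s * s = 1 - 4 * fps_X" by (simp add: power2_eq_square)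
  have "fps_deriv (s * s) = - 4" by (simp add: s2)
  then have "2 * (s * fps_deriv s) = 2 * (- 2)" by (simp add: algebra_simps)
  then have "s * fps_deriv s = - 2" by (simp only: mult_cancel_left) simp
  then have "s * (s * fps_deriv s) = - 2 * s" by simp
  then have ode: "(1 - 4 * fps_X) * fps_deriv s = - 2 * s" by (simp add: mult.assoc[symmetric] s2)
  have sn: "fps_nth s (Suc m) = - 2 * catalan m" for m
    by (simp add: s_def c_def mult.assoc numeral_fps_const)
  \<comment> \<open>At index \<open>Suc n\<close> only the coefficients \<open>n + 1\<close> and
    \<open>n + 2\<close> of \<open>s\<close> occur. Both are positive indices, so \<open>sn\<close>
    turns them into Catalan numbers.\<close>
  have "fps_nth ((1 - 4 * fps_X) * fps_deriv s) (Suc n) = fps_nth (- 2 * s) (Suc n)"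
    using ode by simp
  then show ?thesis
    by (simp add: left_diff_distrib mult.assoc numeral_fps_const sn algebra_simps
        del: catalan.simps)
qed

text \<open>Both sequences start at 1 and satisfy the same two-term recurrence.\<close>

lemma semicircle_moment_even: "semicircle_moment (2 * n) = catalan n"
proof (induction n)
  case 0
  show ?case by (simp add: semicircle_moment_0)
next
  case (Suc n)
  have "(real n + 2) * semicircle_moment (2 * Suc n) = (4 * real n + 2) * catalan n"
    using semicircle_moment_rec[of "2 * n"] Suc by (simp add: algebra_simps)
  also have "\<dots> = (real n + 2) * catalan (Suc n)" using catalan_rec[of n] by simp
  finally show ?case by (simp del: catalan.simps)
qed

section \<open>Matchings and real-rootedness\<close>

text \<open>The edge set is fixed while the vertex set stays a parameter of all notions below:
  deleting vertices then means passing to a smaller \<open>V\<close>, that is, to an induced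
  subgraph.\<close>

locale simple_graph =
  fixes E :: "'a set set"
  assumes card_edge: "e \<in> E \<Longrightarrow> card e = 2"
begin

definition matchings_in :: "'a set \<Rightarrow> 'a set set set" where
  "matchings_in V = {S. S \<subseteq> E \<inter> Pow V \<and> pairwise disjnt S}"

definition nbrs :: "'a set \<Rightarrow> 'a \<Rightarrow> 'a set" where
  "nbrs V v = {w \<in> V. {v, w} \<in> E}"

text \<open>Each edge of a matching has weight \<open>a\<close> and each uncovered vertex weight
  \<open>b\<close>. One recurrence over an arbitrary commutative ring thus serves the matching
  polynomial (\<open>a = -1\<close>, \<open>b\<close> the variable), its complex values, and its
  reversal (\<open>a\<close> minus the squared variable, \<open>b = 1\<close>).\<close>

definition matching_sum :: "'r::comm_ring_1 \<Rightarrow> 'r \<Rightarrow> 'a set \<Rightarrow> 'r" where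
  "matching_sum a b V = (\<Sum>S\<in>matchings_in V. a ^ card S * b ^ (card V - 2 * card S))"

lemma finite_matchings_in: "finite V \<Longrightarrow> finite (matchings_in V)"
  by (rule finite_subset[of _ "Pow (Pow V)"]) (auto simp: matchings_in_def)

lemma finite_nbrs: "finite V \<Longrightarrow> finite (nbrs V v)"
  by (simp add: nbrs_def)

lemma nbrs_irrefl: "v \<notin> nbrs V v"
  using card_edge[of "{v}"] by (auto simp: nbrs_def)

lemma finite_matching: "finite V \<Longrightarrow> S \<in> matchings_in V \<Longrightarrow> finite S"
  by (rule finite_subset[of _ "Pow V"]) (auto simp: matchings_in_def)

lemma card_Union_matching:
  assumes "finite V" "S \<in> matchings_in V"
  shows "card (\<Union>S) = 2 * card S"
proof -
  have "card (\<Union>S) = sum card S"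
    using assms by (intro card_Union_disjoint)
      (auto simp: matchings_in_def intro: finite_subset)
  also have "\<dots> = (\<Sum>e\<in>S. 2)"
    using assms card_edge by (intro sum.cong) (auto simp: matchings_in_def)
  finally show ?thesis by simp
qed

lemma Union_matching_subset: "S \<in> matchings_in V \<Longrightarrow> \<Union>S \<subseteq> V"
  by (auto simp: matchings_in_def)

lemma card_matching_le:
  assumes "finite V" "S \<in> matchings_in V"
  shows "2 * card S \<le> card V"
  using card_mono[OF assms(1) Union_matching_subset[OF assms(2)]] card_Union_matching[OF assms]
  by simp

lemma matchings_in_Diff: "matchings_in (V - {v}) = {S \<in> matchings_in V. v \<notin> \<Union>S}"
  by (auto simp: matchings_in_def)

lemma edge_containing:
  assumes "e \<in> E" "v \<in> e"
  obtains w where "e = {v, w}" "w \<noteq> v"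
proof -
  from card_edge[OF assms(1)] obtain x y where "e = {x, y}" "x \<noteq> y"
    by (auto simp: card_2_iff)
  with assms(2) that[of x] that[of y] show ?thesis by auto
qed

text \<open>A matching either leaves \<open>v\<close> uncovered or contains exactly one edge at
  \<open>v\<close>; removing that edge leaves a matching that avoids both of its ends.\<close>

lemma matchings_in_split:
  assumes "v \<in> V"
  shows "matchings_in V = matchings_in (V - {v}) \<union>
    (\<Union>w\<in>nbrs V v. insert {v, w} ` matchings_in (V - {v, w}))"
proof (intro equalityI subsetI)
  fix S assume S: "S \<in> matchings_in V"
  show "S \<in> matchings_in (V - {v}) \<union>
    (\<Union>w\<in>nbrs V v. insert {v, w} ` matchings_in (V - {v, w}))"
  proof (cases "v \<in> \<Union>S")
    case False
    with S show ?thesis by (simp add: matchings_in_Diff)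
  next
    case True
    then obtain e where e: "e \<in> S" "v \<in> e" by auto
    with S have "e \<in> E" by (auto simp: matchings_in_def)
    from edge_containing[OF this e(2)] obtain w where w: "e = {v, w}" "w \<noteq> v" .
    have "S - {e} \<in> matchings_in (V - {v, w})"
    proof -
      have "v \<notin> e' \<and> w \<notin> e'" if "e' \<in> S" "e' \<noteq> e" for e'
      proof -
        have "disjnt e e'"
          using S e(1) that unfolding matchings_in_def pairwise_def by blast
        then show ?thesis by (auto simp: w disjnt_def)
      qed
      with S show ?thesis by (auto simp: matchings_in_def pairwise_def)
    qed
    moreover have "S = insert {v, w} (S - {e})" using e w by auto
    moreover have "w \<in> nbrs V v" using S e w by (auto simp: nbrs_def matchings_in_def)
    ultimately show ?thesis by blast
  qed
next
  fix S assume "S \<in> matchings_in (V - {v}) \<union>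
    (\<Union>w\<in>nbrs V v. insert {v, w} ` matchings_in (V - {v, w}))"
  then consider "S \<in> matchings_in (V - {v})"
    | w T where "w \<in> nbrs V v" "T \<in> matchings_in (V - {v, w})" "S = insert {v, w} T"
    by blast
  then show "S \<in> matchings_in V"
  proof cases
    case 1 then show ?thesis by (simp add: matchings_in_Diff)
  next
    case 2
    have "disjnt {v, w} e \<and> disjnt e {v, w}" if "e \<in> T" for e
      using 2(2) that by (auto simp: matchings_in_def disjnt_def)
    with 2 assms show ?thesis
      by (auto simp: matchings_in_def nbrs_def pairwise_insert)
  qed
qed

lemma matching_sum_rec:
  assumes "finite V" "v \<in> V"
  shows "matching_sum a b V = b * matching_sum a b (V - {v})
    + a * (\<Sum>w\<in>nbrs V v. matching_sum a b (V - {v, w}))"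
proof -
  let ?t = "\<lambda>S. a ^ card S * b ^ (card V - 2 * card S)"
  let ?I = "\<lambda>w. insert {v, w} ` matchings_in (V - {v, w})"
  have notin: "{v, w} \<notin> T" if "T \<in> matchings_in (V - {v, w})" for w T
    using that by (auto simp: matchings_in_def)
  have finI: "finite (?I w)" for w
    using assms by (intro finite_imageI finite_matchings_in) auto
  have disj: "?I w \<inter> ?I w' = {}" if "w \<in> nbrs V v" "w' \<in> nbrs V v" "w \<noteq> w'" for w w'
  proof -
    have False if T: "T \<in> matchings_in (V - {v, w})"
      and eq: "insert {v, w} T = insert {v, w'} T'" for T T'
    proof -
      have "{v, w'} \<in> insert {v, w} T" using eq by auto
      moreover have "{v, w'} \<noteq> {v, w}" using \<open>w \<noteq> w'\<close> by (auto simp: doubleton_eq_iff)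
      ultimately have "{v, w'} \<in> T" by auto
      with T show False by (auto simp: matchings_in_def)
    qed
    then show ?thesis by blast
  qed
  have "matching_sum a b V = sum ?t (matchings_in (V - {v})) + sum ?t (\<Union>w\<in>nbrs V v. ?I w)"
    unfolding matching_sum_def
  proof (subst matchings_in_split[OF assms(2)], rule sum.union_disjoint)
    show "finite (matchings_in (V - {v}))" using assms by (intro finite_matchings_in) auto
    show "finite (\<Union>w\<in>nbrs V v. ?I w)" using finI finite_nbrs[OF assms(1)] by auto
    show "matchings_in (V - {v}) \<inter> (\<Union>w\<in>nbrs V v. ?I w) = {}"
      by (auto simp: matchings_in_def)
  qed
  also have "sum ?t (matchings_in (V - {v})) = b * matching_sum a b (V - {v})"
    unfolding matching_sum_def sum_distrib_left
  proof (rule sum.cong[OF refl])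
    fix S assume "S \<in> matchings_in (V - {v})"
    \<comment> \<open>The bound keeps the natural-number subtraction from truncating, so one more
      uncovered vertex raises the exponent of \<open>b\<close> by exactly one.\<close>
    then have "2 * card S \<le> card (V - {v})" using assms by (intro card_matching_le) auto
    moreover have "card V = Suc (card (V - {v}))" using card_Suc_Diff1[OF assms] by simp
    ultimately have "card V - 2 * card S = Suc (card (V - {v}) - 2 * card S)" by simp
    then show "?t S = b * (a ^ card S * b ^ (card (V - {v}) - 2 * card S))" by (simp add: ac_simps)
  qed
  also have "sum ?t (\<Union>w\<in>nbrs V v. ?I w) = (\<Sum>w\<in>nbrs V v. sum ?t (?I w))"
    using finI disj by (intro sum.UNION_disjoint finite_nbrs assms(1)) auto
  also have "\<dots> = (\<Sum>w\<in>nbrs V v. a * matching_sum a b (V - {v, w}))"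
  proof (rule sum.cong[OF refl])
    fix w assume w: "w \<in> nbrs V v"
    have "inj_on (insert {v, w}) (matchings_in (V - {v, w}))"
    proof (rule inj_onI)
      fix T T' assume "T \<in> matchings_in (V - {v, w})" "T' \<in> matchings_in (V - {v, w})"
        "insert {v, w} T = insert {v, w} T'"
      with notin[of T w] notin[of T' w] show "T = T'" by (simp add: insert_ident)
    qed
    then have "sum ?t (?I w) = (\<Sum>T\<in>matchings_in (V - {v, w}). ?t (insert {v, w} T))"
      by (simp add: sum.reindex)
    also have "\<dots> = a * matching_sum a b (V - {v, w})"
      unfolding matching_sum_def sum_distrib_left
    proof (rule sum.cong[OF refl])
      fix T assume T: "T \<in> matchings_in (V - {v, w})"
      have "finite T" using T assms finite_matching by blast
      then have c: "card (insert {v, w} T) = Suc (card T)" using notin[OF T] by simp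
      have "w \<noteq> v" "w \<in> V" using w nbrs_irrefl[of v V] by (auto simp: nbrs_def)
      \<comment> \<open>The new edge covers exactly the two deleted vertices, so the exponent of
        \<open>b\<close> stays the same and only a factor \<open>a\<close> appears.\<close>
      then have "card (V - {v, w}) = card V - 2" using assms by (subst card_Diff_subset) auto
      then show "?t (insert {v, w} T) = a * (a ^ card T * b ^ (card (V - {v, w}) - 2 * card T))"
        unfolding c by (simp add: mult.assoc)
    qed
    finally show "sum ?t (?I w) = a * matching_sum a b (V - {v, w})" .
  qed
  finally show ?thesis by (simp add: sum_distrib_left)
qed

lemma matching_sum_empty [simp]: "matching_sum a b {} = 1"
proof -
  have "matchings_in {} = {{}}"
    using card_edge[of "{}"] by (auto simp: matchings_in_def)
  then show ?thesis by (simp add: matching_sum_def)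
qed

text \<open>The ratio \<open>R\<^sub>v = m(G) / m(G - v)\<close> satisfies \<open>R\<^sub>v = z - \<Sum>\<^sub>w 1 / R\<^sub>w\<close>, where the \<open>R\<^sub>w\<close> are taken
  in \<open>G - v\<close>, so by induction it maps the upper half plane to itself.\<close>

lemma matching_sum_upper_half_plane:
  assumes "finite V" "Im z > 0"
  shows "matching_sum (-1) z V \<noteq> 0 \<and>
    (\<forall>v\<in>V. Im (matching_sum (-1) z V / matching_sum (-1) z (V - {v})) > 0)"
  using assms(1)
proof (induction V rule: finite_psubset_induct)
  case (psubset V)
  let ?W = "matching_sum (-1) z"
  have *: "Im (?W V / ?W (V - {v})) > 0" if v: "v \<in> V" for v
  proof -
    have sub: "V - {v} \<subset> V" using v by auto
    have nz: "?W (V - {v}) \<noteq> 0" using psubset.IH[OF sub] by simp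
    have "Im (?W (V - {v, w}) / ?W (V - {v})) < 0" if "w \<in> nbrs V v" for w
    proof -
      have "w \<in> V - {v}" using that nbrs_irrefl[of v V] by (auto simp: nbrs_def)
      with psubset.IH[OF sub] have "Im (?W (V - {v}) / ?W (V - {v} - {w})) > 0" by blast
      moreover have "V - {v} - {w} = V - {v, w}" by auto
      \<comment> \<open>Inversion reverses the sign of the imaginary part.\<close>
      ultimately have "Im (inverse (?W (V - {v}) / ?W (V - {v, w}))) < 0"
        unfolding inverse_complex.sel
        by (intro divide_neg_pos) (simp_all only: sum_power2_gt_zero_iff, auto)
      then show ?thesis by simp
    qed
    \<comment> \<open>Only a weak inequality, since \<open>v\<close> may be isolated; strictness
      comes from \<open>Im z > 0\<close>.\<close>
    then have "(\<Sum>w\<in>nbrs V v. Im (?W (V - {v, w}) / ?W (V - {v}))) \<le> 0"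
      by (intro sum_nonpos) (auto intro: less_imp_le)
    moreover have "?W V / ?W (V - {v}) = z - (\<Sum>w\<in>nbrs V v. ?W (V - {v, w}) / ?W (V - {v}))"
      using nz by (subst matching_sum_rec[OF psubset.hyps v])
        (simp add: diff_divide_distrib sum_divide_distrib)
    ultimately show ?thesis using assms(2) by simp
  qed
  moreover have "?W V \<noteq> 0"
  proof (cases "V = {}")
    case False
    then obtain v where "v \<in> V" by auto
    \<comment> \<open>A zero numerator would make the ratio 0, whose imaginary part is not
      positive.\<close>
    with *[OF this] show ?thesis by auto
  qed simp
  ultimately show ?case by blast
qed

text \<open>Ring homomorphisms commute with \<open>matching_sum\<close>. This is applied to complex
  conjugation, to evaluation of polynomials, and to the embedding of polynomials into power
  series.\<close>

lemma matching_sum_hom: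
  assumes "h 0 = 0" "h 1 = 1" "\<And>x y. h (x + y) = h x + h y" "\<And>x y. h (x * y) = h x * h y"
  shows "h (matching_sum a b V) = matching_sum (h a) (h b) V"
proof -
  have p: "h (x ^ n) = h x ^ n" for x n by (induction n) (auto simp: assms)
  have "h (sum f A) = (\<Sum>x\<in>A. h (f x))" for f and A :: "'a set set set"
    by (induction A rule: infinite_finite_induct) (auto simp: assms)
  then show ?thesis by (simp add: matching_sum_def assms p)
qed

text \<open>Conjugation carries the lower half plane to the upper one. With \<open>b\<close> read as
  the variable this is the Heilmann-Lieb theorem.\<close>

lemma matching_sum_nonreal:
  assumes "finite V" "Im z \<noteq> 0"
  shows "matching_sum (-1) z V \<noteq> 0"
proof (cases "Im z > 0")
  case True
  then show ?thesis using matching_sum_upper_half_plane[OF assms(1)] by blast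
next
  case False
  then have "Im (cnj z) > 0" using assms(2) by simp
  then have "matching_sum (-1) (cnj z) V \<noteq> 0"
    using matching_sum_upper_half_plane[OF assms(1)] by blast
  also have "matching_sum (-1) (cnj z) V = cnj (matching_sum (-1) z V)"
    by (subst matching_sum_hom[of cnj]) auto
  finally show ?thesis by simp
qed

text \<open>With \<open>X = 1/x\<close>, \<open>gen_fun V\<close> is \<open>x\<^sup>-\<^sup>n m(G[V], x)\<close> for \<open>n = |V|\<close>; the coefficients of \<open>walk_fun V v\<close> count
  Godsil's closed tree-like walks from \<open>v\<close>.\<close>

definition gen_fun :: "'a set \<Rightarrow> real fps" where
  "gen_fun V = matching_sum (- (fps_X ^ 2)) 1 V"

definition walk_fun :: "'a set \<Rightarrow> 'a \<Rightarrow> real fps" where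
  "walk_fun V v = gen_fun (V - {v}) * inverse (gen_fun V)"

text \<open>Only the empty matching contributes a constant term. Hence \<open>gen_fun V\<close> is
  invertible and the quotient \<open>walk_fun\<close> behaves as a true quotient.\<close>

lemma gen_fun_nth_0: "finite V \<Longrightarrow> fps_nth (gen_fun V) 0 = 1"
proof -
  assume fin: "finite V"
  have "fps_nth (gen_fun V) 0 = (\<Sum>S\<in>matchings_in V. if S = {} then 1 else 0)"
    unfolding gen_fun_def matching_sum_def fps_sum_nth
    using finite_matching[OF fin]
    by (intro sum.cong) (auto simp: fps_nth_power_0 power_0_left)
  also have "\<dots> = 1"
    using finite_matchings_in[OF fin] by (simp add: matchings_in_def)
  finally show ?thesis .
qed

lemma inverse_gen_fun: "finite V \<Longrightarrow> inverse (gen_fun V) * gen_fun V = 1"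
  by (rule inverse_mult_eq_1) (simp add: gen_fun_nth_0)

lemma walk_fun_rec:
  assumes "finite V" "v \<in> V"
  shows "walk_fun V v = 1 + fps_X ^ 2 * (\<Sum>w\<in>nbrs V v. walk_fun (V - {v}) w) * walk_fun V v"
proof -
  let ?g = gen_fun
  have fin: "finite (V - {v})" using assms by simp
  have "?g V = ?g (V - {v}) - fps_X ^ 2 * (\<Sum>w\<in>nbrs V v. ?g (V - {v, w}))"
    unfolding gen_fun_def by (subst matching_sum_rec[OF assms]) simp
  then have "?g (V - {v}) = ?g V + fps_X ^ 2 * (\<Sum>w\<in>nbrs V v. ?g (V - {v, w}))" by simp
  also have "(\<Sum>w\<in>nbrs V v. ?g (V - {v, w})) =
      (\<Sum>w\<in>nbrs V v. walk_fun (V - {v}) w) * ?g (V - {v})"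
    unfolding sum_distrib_right walk_fun_def
  proof (rule sum.cong[OF refl])
    fix w
    have "V - {v} - {w} = V - {v, w}" by auto
    then show "?g (V - {v, w}) = ?g (V - {v} - {w}) * inverse (?g (V - {v})) * ?g (V - {v})"
      by (simp add: mult.assoc inverse_gen_fun[OF fin])
  qed
  finally have "walk_fun V v = (?g V + fps_X ^ 2 *
      ((\<Sum>w\<in>nbrs V v. walk_fun (V - {v}) w) * ?g (V - {v}))) * inverse (?g V)"
    by (simp add: walk_fun_def)
  also have "\<dots> = inverse (?g V) * ?g V + fps_X ^ 2 * (\<Sum>w\<in>nbrs V v. walk_fun (V - {v}) w) * walk_fun V v"
    unfolding walk_fun_def[of V] by (simp only: ring_distribs mult_ac)
  finally show ?thesis
    by (simp only: inverse_gen_fun[OF assms(1)])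
qed

text \<open>Double counting of pairs of a matching \<open>S\<close> and a vertex outside it:
  \<open>S\<close> leaves \<open>card V - 2 * card S\<close> vertices uncovered, and the operator X
  d/dX multiplies its term by \<open>2 * card S\<close>. This is the identity m' = sum of m(G - v)
  after reversal.\<close>

lemma sum_gen_fun_Diff:
  assumes "finite V"
  shows "(\<Sum>v\<in>V. gen_fun (V - {v})) = of_nat (card V) * gen_fun V - fps_X * fps_deriv (gen_fun V)"
proof -
  let ?t = "\<lambda>S::'a set set. (- (fps_X ^ 2) :: real fps) ^ card S"
  have g: "gen_fun U = sum ?t (matchings_in U)" for U by (simp add: gen_fun_def matching_sum_def)
  have fin: "finite (matchings_in V)" by (rule finite_matchings_in[OF assms])
  have "(\<Sum>v\<in>V. gen_fun (V - {v})) = (\<Sum>v\<in>V. \<Sum>S\<in>matchings_in V. if v \<notin> \<Union>S then ?t S else 0)"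
    unfolding g matchings_in_Diff using fin
    by (intro sum.cong refl sum.mono_neutral_cong_left) auto
  also have "\<dots> = (\<Sum>S\<in>matchings_in V. \<Sum>v\<in>V. if v \<notin> \<Union>S then ?t S else 0)" by (rule sum.swap)
  also have "\<dots> = (\<Sum>S\<in>matchings_in V. of_nat (card V) * ?t S - of_nat (2 * card S) * ?t S)"
  proof (rule sum.cong[OF refl])
    fix S assume S: "S \<in> matchings_in V"
    have "(\<Sum>v\<in>V. if v \<notin> \<Union>S then ?t S else 0) = (\<Sum>v\<in>V - \<Union>S. ?t S)"
      using assms by (intro sum.mono_neutral_cong_right) auto
    also have "\<dots> = of_nat (card V - 2 * card S) * ?t S"
      using Union_matching_subset[OF S] assms
      by (simp add: card_Diff_subset finite_subset card_Union_matching[OF assms S])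
    finally show "(\<Sum>v\<in>V. if v \<notin> \<Union>S then ?t S else 0) =
        of_nat (card V) * ?t S - of_nat (2 * card S) * ?t S"
      using card_matching_le[OF assms S] by (simp only: of_nat_diff left_diff_distrib)
  qed
  also have "\<dots> = of_nat (card V) * gen_fun V - (\<Sum>S\<in>matchings_in V. of_nat (2 * card S) * ?t S)"
    by (simp only: g sum_subtractf sum_distrib_left)
  also have "(\<Sum>S\<in>matchings_in V. of_nat (2 * card S) * ?t S) = fps_X * fps_deriv (gen_fun V)"
  proof -
    have "fps_X * fps_deriv ((- (fps_X ^ 2) :: real fps) ^ c) = of_nat (2 * c) * (- (fps_X ^ 2)) ^ c"
      for c
    proof (cases c)
      case (Suc d)
      have X2: "fps_deriv (- (fps_X ^ 2) :: real fps) = - 2 * fps_X"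
        by (simp add: fps_deriv_power power2_eq_square)
      show ?thesis
        unfolding Suc fps_deriv_power X2
        by (simp add: power2_eq_square algebra_simps flip: fps_of_nat)
    qed simp
    then show ?thesis by (simp only: g fps_deriv_sum sum_distrib_left)
  qed
  finally show ?thesis .
qed

lemma sum_walk_fun:
  assumes "finite V"
  shows "(\<Sum>v\<in>V. walk_fun V v) * gen_fun V = of_nat (card V) * gen_fun V - fps_X * fps_deriv (gen_fun V)"
proof -
  have "(\<Sum>v\<in>V. walk_fun V v) * gen_fun V = (\<Sum>v\<in>V. gen_fun (V - {v}))"
    unfolding sum_distrib_right walk_fun_def
    by (simp add: mult.assoc inverse_gen_fun[OF assms])
  then show ?thesis using sum_gen_fun_Diff[OF assms] by simp
qed

end

section \<open>Real-rooted polynomials and generating functions of power sums\<close>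

lemma map_poly_of_real_add:
  "map_poly of_real (p + q) = map_poly of_real p + (map_poly of_real q :: 'a::real_algebra_1 poly)"
  by (intro poly_eqI) (simp add: coeff_map_poly)

lemma map_poly_of_real_mult:
  "map_poly of_real (p * q) = map_poly of_real p * (map_poly of_real q :: 'a::{real_algebra_1, comm_ring_1} poly)"
  by (intro poly_eqI) (simp add: coeff_map_poly coeff_mult)

lemma map_poly_of_real_uminus:
  "map_poly of_real (- p) = - (map_poly of_real p :: 'a::real_algebra_1 poly)"
  by (intro poly_eqI) (simp add: coeff_map_poly)

text \<open>Induction on the degree: the fundamental theorem of algebra gives a complex zero, which
  is real by assumption, and the quotient by its linear factor inherits the assumption.\<close>

lemma real_rooted_factorization:
  fixes p :: "real poly"
  assumes "\<And>z::complex. poly (map_poly of_real p) z = 0 \<Longrightarrow> Im z = 0"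
  shows "\<exists>xs. length xs = degree p \<and> p = smult (lead_coeff p) (\<Prod>x\<leftarrow>xs. [:-x, 1:])"
  using assms
proof (induction "degree p" arbitrary: p)
  case 0
  then show ?case by (auto elim!: degree_eq_zeroE)
next
  case (Suc d)
  have "degree (map_poly complex_of_real p) = degree p" by (rule degree_map_poly) auto
  then have "\<not> constant (poly (map_poly complex_of_real p))"
    using Suc.hyps(2) by (simp add: constant_degree)
  then obtain z where z: "poly (map_poly complex_of_real p) z = 0"
    using fundamental_theorem_of_algebra by blast
  have "complex_of_real (Re z) = z" using Suc.prems[OF z] by (simp add: complex_eq_iff)
  with z have "poly (map_poly complex_of_real p) (of_real (Re z)) = 0" by simp
  moreover have "poly (map_poly complex_of_real p) (of_real x) = of_real (poly p x)" for x
    by (induction p) (simp_all add: map_poly_pCons)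
  ultimately have "poly p (Re z) = 0" by simp
  then obtain q where q: "p = [:- Re z, 1:] * q" unfolding poly_eq_0_iff_dvd by (rule dvdE)
  have "q \<noteq> 0" using q Suc.hyps(2) by auto
  have "degree p = Suc (degree q)" unfolding q by (subst degree_mult_eq) (use \<open>q \<noteq> 0\<close> in auto)
  with Suc.hyps(2) have "d = degree q" by simp
  moreover have "Im w = 0" if "poly (map_poly of_real q) w = 0" for w :: complex
    using that by (intro Suc.prems) (simp add: q map_poly_of_real_mult del: mult_pCons_left)
  ultimately obtain xs where xs: "length xs = degree q"
      "q = smult (lead_coeff q) (\<Prod>x\<leftarrow>xs. [:-x, 1:])"
    using Suc.hyps(1) by blast
  have "p = smult (lead_coeff q) ([:- Re z, 1:] * (\<Prod>x\<leftarrow>xs. [:-x, 1:]))"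
    by (subst q, subst xs(2)) (simp only: mult_smult_right)
  moreover have "lead_coeff p = lead_coeff q" unfolding q lead_coeff_mult by simp
  ultimately have "p = smult (lead_coeff p) (\<Prod>x\<leftarrow>Re z # xs. [:-x, 1:])"
    by (simp only: list.map prod_list.Cons)
  moreover have "length (Re z # xs) = degree p"
    using xs(1) \<open>degree p = Suc (degree q)\<close> by simp
  ultimately show ?case by blast
qed

lemma proots_linear_factors: "proots (\<Prod>x\<leftarrow>xs. [:-x, 1::real:]) = mset xs"
proof (induction xs)
  case (Cons x xs)
  have "(\<Prod>x\<leftarrow>xs. [:-x, 1::real:]) \<noteq> 0" by (auto simp: prod_list_zero_iff)
  then show ?case using Cons by (simp add: proots_mult del: mult_pCons_left)
qed simp

text \<open>Newton's identities in logarithmic-derivative form, multiplied by \<open>P\<close> to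
  avoid division: each geometric series is the inverse of one linear factor. The shape matches that
  of \<open>sum_walk_fun\<close>.\<close>

lemma fps_log_deriv_linear_factors:
  fixes xs :: "real list"
  defines "P \<equiv> \<Prod>x\<leftarrow>xs. 1 - fps_const x * fps_X"
  shows "P * (\<Sum>x\<leftarrow>xs. Abs_fps (\<lambda>k. x ^ k)) = of_nat (length xs) * P - fps_X * fps_deriv P"
  unfolding P_def
proof (induction xs)
  case (Cons x xs)
  let ?P = "\<Prod>x\<leftarrow>xs. 1 - fps_const x * fps_X" and ?l = "1 - fps_const x * fps_X"
  let ?S = "\<Sum>x\<leftarrow>xs. Abs_fps (\<lambda>k. x ^ k)"
  have geo: "?l * Abs_fps (\<lambda>k. x ^ k) = 1"
  proof (rule fps_ext)
    fix n show "fps_nth (?l * Abs_fps (\<lambda>k. x ^ k)) n = fps_nth 1 n"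
      by (cases n) (simp_all add: left_diff_distrib mult.assoc)
  qed
  have ring: "(l * P) * (g + S) = (l * g) * P + l * (P * S)" for l P g S :: "real fps"
    by (simp add: algebra_simps)
  have "(?l * ?P) * (Abs_fps (\<lambda>k. x ^ k) + ?S) = (?l * Abs_fps (\<lambda>k. x ^ k)) * ?P + ?l * (?P * ?S)"
    by (rule ring)
  also have "\<dots> = ?P + ?l * (of_nat (length xs) * ?P - fps_X * fps_deriv ?P)"
    unfolding geo Cons by simp
  also have "\<dots> = of_nat (Suc (length xs)) * (?l * ?P) - fps_X * fps_deriv (?l * ?P)"
    by (simp add: algebra_simps)
  finally show ?case by simp
qed simp

section \<open>Roots of the matching polynomial and their power sums\<close>

context simple_graph
begin

lemma matching_sum_monom:
  "matching_sum (-1) [:0, 1:] V =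
    (\<Sum>S\<in>matchings_in V. monom ((-1) ^ card S) (card V - 2 * card S) :: real poly)"
  unfolding matching_sum_def
proof (rule sum.cong[OF refl])
  fix S :: "'a set set"
  show "(-1) ^ card S * [:0, 1:] ^ (card V - 2 * card S) =
      (monom ((-1) ^ card S) (card V - 2 * card S) :: real poly)"
    by (cases "even (card S)") (simp_all add: monom_altdef)
qed

text \<open>The exponent \<open>card V\<close> is reached by the empty matching alone.\<close>

lemma matching_sum_monic:
  assumes "finite V"
  shows "degree (matching_sum (-1) [:0, 1:] V :: real poly) = card V"
    and "lead_coeff (matching_sum (-1) [:0, 1:] V :: real poly) = 1"
proof -
  let ?W = "matching_sum (-1) [:0, 1:] V :: real poly"
  note W = matching_sum_monom[of V]
  have le: "degree ?W \<le> card V"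
    unfolding W
    by (intro degree_sum_le finite_matchings_in assms order_trans[OF degree_monom_le] diff_le_self)
  have "coeff ?W (card V) = (\<Sum>S\<in>matchings_in V. if S = {} then 1 else 0)"
    unfolding W coeff_sum
  proof (rule sum.cong[OF refl])
    fix S assume S: "S \<in> matchings_in V"
    show "coeff (monom ((-1) ^ card S) (card V - 2 * card S)) (card V) = (if S = {} then 1 else 0 :: real)"
    proof (cases "S = {}")
      case False
      then have "card S > 0" using finite_matching[OF assms S] by (simp add: card_gt_0_iff)
      with False card_matching_le[OF assms S] show ?thesis by simp
    qed simp
  qed
  also have "\<dots> = 1"
    using finite_matchings_in[OF assms] by (simp add: matchings_in_def)
  finally have c: "coeff ?W (card V) = 1" .
  then have "card V \<le> degree ?W" by (intro le_degree) simp
  with le show d: "degree ?W = card V" by simp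
  show "lead_coeff ?W = 1" using c by (simp only: d)
qed

lemma matching_sum_linear_factors:
  assumes "finite V"
  obtains xs :: "real list" where "length xs = card V"
    "matching_sum (-1) [:0, 1:] V = (\<Prod>x\<leftarrow>xs. [:-x, 1:])"
proof -
  let ?W = "matching_sum (-1) [:0, 1:] V :: real poly"
  have "poly (map_poly of_real ?W) z = matching_sum (-1) z V" for z :: complex
    by (subst matching_sum_hom[of "\<lambda>p. poly (map_poly of_real p) z"])
       (simp_all add: map_poly_of_real_add map_poly_of_real_mult map_poly_of_real_uminus map_poly_pCons)
  then have "Im z = 0" if "poly (map_poly of_real ?W) z = 0" for z :: complex
    using that matching_sum_nonreal[OF assms] by metis
  then obtain xs where "length xs = degree ?W"
      "?W = smult (lead_coeff ?W) (\<Prod>x\<leftarrow>xs. [:-x, 1:])"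
    using real_rooted_factorization[of ?W] by blast
  with that[of xs] matching_sum_monic[OF assms] show ?thesis by simp
qed

text \<open>Both sides are the reversal of the matching polynomial, t^n m(1/t). Equality is shown
  for polynomials by comparing values at nonzero \<open>t\<close> and is then carried over to power
  series.\<close>

lemma gen_fun_linear_factors:
  assumes "finite V" "length xs = card V"
    "matching_sum (-1) [:0, 1:] V = (\<Prod>x\<leftarrow>xs. [:-x, 1::real:])"
  shows "gen_fun V = (\<Prod>x\<leftarrow>xs. 1 - fps_const x * fps_X)"
proof -
  define R where "R = (\<Prod>x\<leftarrow>xs. [:1, -x:])"
  define Q where "Q = matching_sum (- ([:0, 1 :: real:] ^ 2)) 1 V"
  have "poly R t = poly Q t" if "t \<noteq> 0" for t
  proof -
    have "poly R t = t ^ length xs * (\<Prod>x\<leftarrow>xs. 1 / t - x)"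
      unfolding R_def using that by (induction xs) (simp_all add: field_simps)
    also have "(\<Prod>x\<leftarrow>xs. 1 / t - x) = poly (matching_sum (-1) [:0, 1:] V) (1 / t)"
      unfolding assms(3) by (induction xs) (simp_all add: left_diff_distrib)
    also have "\<dots> = matching_sum (-1) (1 / t) V"
      by (subst matching_sum_hom[of "\<lambda>p. poly p (1 / t)"]) simp_all
    also have "t ^ length xs * \<dots> = matching_sum (- (t ^ 2)) 1 V"
      unfolding matching_sum_def assms(2) sum_distrib_left
    proof (rule sum.cong[OF refl])
      fix S assume S: "S \<in> matchings_in V"
      have "t ^ card V = t ^ (card V - 2 * card S) * (t ^ 2) ^ card S"
        using card_matching_le[OF assms(1) S] by (simp flip: power_add power_mult)
      moreover have "t ^ (card V - 2 * card S) * (1 / t) ^ (card V - 2 * card S) = 1"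
        using that by (simp flip: power_mult_distrib)
      moreover have "(- (t ^ 2)) ^ card S = (-1) ^ card S * (t ^ 2) ^ card S"
        by (rule power_minus)
      ultimately show "t ^ card V * ((- 1) ^ card S * (1 / t) ^ (card V - 2 * card S)) =
          (- (t ^ 2)) ^ card S * 1 ^ (card V - 2 * card S)"
        by (simp add: ac_simps)
    qed
    also have "\<dots> = poly Q t"
      unfolding Q_def by (subst matching_sum_hom[of "\<lambda>p. poly p t"]) (simp_all add: power2_eq_square)
    finally show ?thesis .
  qed
  \<comment> \<open>The extra factor vanishes at 0, the one point where the values were not
    compared.\<close>
  then have "\<forall>t. poly ([:0, 1:] * (R - Q)) t = 0" by auto
  then have "[:0, 1:] * (R - Q) = 0" by (simp only: poly_all_0_iff_0)
  then have "R = Q" by simp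
  moreover have "fps_of_poly R = (\<Prod>x\<leftarrow>xs. 1 - fps_const x * fps_X)"
    unfolding R_def by (induction xs) (simp_all add: fps_of_poly_mult fps_of_poly_linear' del: mult_pCons_left flip: fps_const_neg)
  moreover have "fps_of_poly Q = gen_fun V"
    unfolding Q_def gen_fun_def
    by (subst matching_sum_hom[of fps_of_poly])
       (simp_all add: fps_of_poly_add fps_of_poly_mult fps_of_poly_uminus fps_of_poly_power del: mult_pCons_left)
  ultimately show ?thesis by simp
qed

text \<open>The generating functions of both sides, multiplied by \<open>gen_fun V\<close>, give the
  same expression by the two logarithmic-derivative identities; the nonzero factor cancels.\<close>

lemma power_sum_roots:
  assumes "finite V" "length xs = card V"
    "matching_sum (-1) [:0, 1:] V = (\<Prod>x\<leftarrow>xs. [:-x, 1::real:])"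
  shows "(\<Sum>x\<leftarrow>xs. x ^ k) = (\<Sum>v\<in>V. fps_nth (walk_fun V v) k)"
proof -
  let ?S = "\<Sum>x\<leftarrow>xs. Abs_fps (\<lambda>k. x ^ k)"
  have "gen_fun V * ?S = (\<Sum>v\<in>V. walk_fun V v) * gen_fun V"
    unfolding sum_walk_fun[OF assms(1)] unfolding gen_fun_linear_factors[OF assms]
    by (simp only: fps_log_deriv_linear_factors assms(2))
  moreover have "gen_fun V \<noteq> 0" using gen_fun_nth_0[OF assms(1)] by auto
  ultimately have "?S = (\<Sum>v\<in>V. walk_fun V v)" by (simp add: mult.commute)
  moreover have "fps_nth ?S k = (\<Sum>x\<leftarrow>xs. x ^ k)" by (induction xs) simp_all
  ultimately show ?thesis by (simp add: fps_sum_nth)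
qed

lemma matching_poly_eq:
  assumes "finite V" "E \<subseteq> all_edges V"
  shows "matching_poly V E = matching_sum (-1) [:0, 1:] V"
proof -
  let ?n = "card V"
  let ?f = "\<lambda>S. monom ((-1) ^ card S) (?n - 2 * card S) :: real poly"
  have k: "k_matchings E k = {S \<in> matchings_in V. card S = k}" for k
    using assms finite_matching[OF assms(1)]
    by (auto simp: k_matchings_def matchings_in_def all_edges_def)
  have "matching_poly V E = (\<Sum>k\<le>?n div 2. \<Sum>S\<in>{S \<in> matchings_in V. card S = k}. ?f S)"
    unfolding matching_poly_def k
  proof (rule sum.cong[OF refl])
    fix k
    let ?M = "{S \<in> matchings_in V. card S = k}"
    have "(\<Sum>S\<in>?M. ?f S) = (\<Sum>S\<in>?M. monom ((-1) ^ k) (?n - 2 * k))"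
      by (rule sum.cong) auto
    also have "\<dots> = monom ((-1) ^ k * real (card ?M)) (?n - 2 * k)"
      by (simp add: of_nat_poly monom_altdef mult.commute)
    finally show "monom ((-1) ^ k * real (card ?M)) (?n - 2 * k) = (\<Sum>S\<in>?M. ?f S)" by simp
  qed
  also have "\<dots> = (\<Sum>S\<in>matchings_in V. ?f S)"
  proof (rule sum.group)
    show "card ` matchings_in V \<subseteq> {..?n div 2}"
      using card_matching_le[OF assms(1)] by fastforce
  qed (simp_all add: finite_matchings_in assms)
  also have "\<dots> = matching_sum (-1) [:0, 1:] V"
    by (rule matching_sum_monom[symmetric])
  finally show ?thesis .
qed

end

section \<open>Degrees of the random graph\<close>

text \<open>Independence of events extends to the sigma-algebras they generate, and these contain
  all preimages of Borel sets under the indicators.\<close>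

lemma (in prob_space) indep_vars_indicator:
  assumes "indep_events A I"
  shows "indep_vars (\<lambda>_. borel) (\<lambda>i. indicator (A i) :: 'a \<Rightarrow> real) I"
proof -
  have A: "A i \<in> events" if "i \<in> I" for i
    using assms that by (auto simp: indep_events_def)
  have "indep_sets (\<lambda>i. sigma_sets (space M) {A i}) I"
    using assms unfolding indep_events_def_alt
    by (intro indep_sets_sigma) (auto simp: Int_stable_def)
  moreover have "{(indicator (A i) :: 'a \<Rightarrow> real) -` B \<inter> space M |B. B \<in> sets borel}
      \<subseteq> sigma_sets (space M) {A i}" if i: "i \<in> I" for i
  proof -
    have sub: "A i \<subseteq> space M" using A[OF i] by (rule sets.sets_into_space)
    let ?N = "sigma (space M) {A i}"
    have "A i \<in> sets ?N" using sub by auto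
    then have "indicator (A i) \<in> borel_measurable ?N" by (rule borel_measurable_indicator)
    from measurable_sets[OF this] show ?thesis using sub by auto
  qed
  ultimately show ?thesis
    using A unfolding indep_vars_def2
    by (auto intro: indep_sets_mono_sets)
qed

text \<open>The degree of \<open>v\<close> is a sum of \<open>card V - 1\<close> independent
  indicators, each with mean \<open>p\<close>, so Hoeffding's inequality applies.\<close>

lemma degree_deviation:
  assumes er: "erdos_renyi M p V G" and V: "finite V" "v \<in> V" "card V > 1" and "\<epsilon> \<ge> 0"
  defines "B \<equiv> {\<omega>\<in>space M. \<epsilon> \<le> \<bar>real (card {w\<in>V. {v, w} \<in> G \<omega>}) - (real (card V) - 1) * p\<bar>}"
  shows "B \<in> sets M" and "measure M B \<le> 2 * exp (- 2 * \<epsilon>\<^sup>2 / (real (card V) - 1))"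
proof -
  interpret prob_space M using er by (simp add: erdos_renyi_def)
  define A where "A = (\<lambda>e. {\<omega>\<in>space M. e \<in> G \<omega>})"
  define I where "I = (\<lambda>w. {v, w}) ` (V - {v})"
  have inj: "inj_on (\<lambda>w. {v, w}) (V - {v})" by (auto simp: inj_on_def doubleton_eq_iff)
  have I: "I \<subseteq> all_edges V" using V by (auto simp: I_def all_edges_def card_2_iff)
  have finI: "finite I" using V by (simp add: I_def)
  have cardI: "real (card I) = real (card V) - 1"
    using V by (simp add: I_def card_image[OF inj] of_nat_diff)
  have "indep_events A (all_edges V)" using er by (simp add: erdos_renyi_def A_def)
  then have indep: "indep_events A I"
    unfolding indep_events_def_alt by (rule indep_sets_mono_index[OF I])
  have A: "A e \<in> events" "prob (A e) = p" if "e \<in> I" for e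
  proof -
    show "A e \<in> events" using indep that by (auto simp: indep_events_def)
    show "prob (A e) = p" using er I that by (auto simp: erdos_renyi_def A_def)
  qed
  have deg: "real (card {w\<in>V. {v, w} \<in> G \<omega>}) = (\<Sum>e\<in>I. indicator (A e) \<omega>)" if "\<omega> \<in> space M" for \<omega>
  proof -
    have "G \<omega> \<subseteq> all_edges V" using er that unfolding erdos_renyi_def by blast
    \<comment> \<open>The choice \<open>w = v\<close> would give the set
      \<open>{v, v} = {v}\<close>, which is not an edge.\<close>
    then have "{v} \<notin> G \<omega>" by (auto simp: all_edges_def)
    then have "{w\<in>V. {v, w} \<in> G \<omega>} = {w\<in>V - {v}. {v, w} \<in> G \<omega>}" by auto
    moreover have "(\<Sum>e\<in>I. indicator (A e) \<omega>) = (\<Sum>w\<in>V - {v}. if {v, w} \<in> G \<omega> then 1 else (0::real))"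
      unfolding I_def using that by (subst sum.reindex[OF inj]) (auto simp: A_def indicator_def of_bool_def intro!: sum.cong)
    ultimately show ?thesis using V by (simp add: sum.If_cases Int_def)
  qed
  have mu: "(\<Sum>e\<in>I. expectation (indicator (A e))) = (real (card V) - 1) * p"
    using A by (simp add: cardI)
  have B: "B = {\<omega>\<in>space M. \<epsilon> \<le> \<bar>(\<Sum>e\<in>I. indicator (A e) \<omega>) - (\<Sum>e\<in>I. expectation (indicator (A e)))\<bar>}"
    unfolding B_def mu using deg by auto
  have [measurable]: "indicator (A e) \<in> borel_measurable M" if "e \<in> I" for e
    using A that by (intro borel_measurable_indicator)
  show "B \<in> sets M" unfolding B by measurable
  interpret H: Hoeffding_ineq M I "\<lambda>e. indicator (A e)" "\<lambda>_. 0" "\<lambda>_. 1"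
    "\<Sum>e\<in>I. expectation (indicator (A e))"
  proof unfold_locales
    show "finite I" by (rule finI)
    show "indep_vars (\<lambda>_. borel) (\<lambda>e. indicator (A e) :: _ \<Rightarrow> real) I"
      by (rule indep_vars_indicator[OF indep])
    show "AE \<omega> in M. indicator (A e) \<omega> \<in> {0..1::real}" for e
      by (intro AE_I2) simp
  qed simp
  have "0 < (\<Sum>e\<in>I. (1 - 0 :: real)\<^sup>2)" using cardI V by simp
  from H.Hoeffding_ineq_abs_ge[OF \<open>\<epsilon> \<ge> 0\<close> this]
  have "measure M B \<le> 2 * exp (- 2 * \<epsilon>\<^sup>2 / (\<Sum>e\<in>I. (1 - 0)\<^sup>2))" by (simp only: B)
  then show "measure M B \<le> 2 * exp (- 2 * \<epsilon>\<^sup>2 / (real (card V) - 1))" by (simp add: cardI)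
qed

lemma summable_of_nat_mult_exp:
  assumes "c > (0::real)"
  shows "summable (\<lambda>n. real n * exp (- c * real n))"
proof (rule summable_comparison_test)
  have "norm (exp (- c)) < 1" using assms by simp
  from geometric_deriv_sums[OF this] show "summable (\<lambda>n. real (Suc n) * exp (- c) ^ n)"
    by (auto simp: sums_iff)
  show "\<exists>N. \<forall>n\<ge>N. norm (real n * exp (- c * real n)) \<le> real (Suc n) * exp (- c) ^ n"
    by (auto simp: exp_of_nat_mult[symmetric] mult.commute intro!: mult_mono)
qed

lemma degrees_concentrate_eps:
  fixes G :: "nat \<Rightarrow> 'w \<Rightarrow> nat set set"
  assumes er: "\<And>n. erdos_renyi M p {1..n} (G n)" and p: "0 \<le> p" "p \<le> 1" and eps: "\<epsilon> > 0"
  shows "AE \<omega> in M. \<forall>\<^sub>F n in sequentially.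
    \<forall>v\<in>{1..n}. \<bar>real (card {w\<in>{1..n}. {v, w} \<in> G n \<omega>}) - real n * p\<bar> \<le> \<epsilon> * real n"
proof -
  interpret prob_space M using er[of 0] by (simp add: erdos_renyi_def)
  \<comment> \<open>One half of \<epsilon> bounds the deviation from the mean
    \<open>(n - 1) * p\<close>; the other half absorbs the difference \<open>p\<close> between this
    mean and \<open>n * p\<close>.\<close>
  define \<delta> where "\<delta> = \<epsilon> / 2"
  have d: "\<delta> > 0" using eps by (simp add: \<delta>_def)
  define D where "D n v = {\<omega>\<in>space M. \<delta> * real n \<le>
    \<bar>real (card {w\<in>{1..n}. {v, w} \<in> G n \<omega>}) - (real n - 1) * p\<bar>}" for n v
  define B where "B n = (if n > 1 then \<Union>v\<in>{1..n}. D n v else {})" for n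
  have D: "D n v \<in> events" "prob (D n v) \<le> 2 * exp (- (2 * \<delta>\<^sup>2) * real n)"
    if "n > 1" "v \<in> {1..n}" for n v
  proof -
    have "finite {1..n}" "card {1..n} > 1" "0 \<le> \<delta> * real n" using that d by auto
    note dev = degree_deviation[OF er[of n] this(1) that(2) this(2,3)]
    have cn: "real (card {1..n}) = real n" by simp
    show "D n v \<in> events" unfolding D_def by (rule dev(1)[unfolded cn])
    have "prob (D n v) \<le> 2 * exp (- 2 * (\<delta> * real n)\<^sup>2 / (real n - 1))"
      unfolding D_def by (rule dev(2)[unfolded cn])
    also have "\<dots> \<le> 2 * exp (- (2 * \<delta>\<^sup>2) * real n)"
    proof -
      have "2 * \<delta>\<^sup>2 * real n * (real n - 1) \<le> 2 * (\<delta> * real n)\<^sup>2"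
        using that d by (simp add: power2_eq_square algebra_simps)
      then have "2 * \<delta>\<^sup>2 * real n \<le> 2 * (\<delta> * real n)\<^sup>2 / (real n - 1)"
        using that by (simp add: pos_le_divide_eq)
      then show ?thesis by simp
    qed
    finally show "prob (D n v) \<le> 2 * exp (- (2 * \<delta>\<^sup>2) * real n)" .
  qed
  have B: "B n \<in> events" for n using D(1) by (auto simp: B_def)
  have "prob (B n) \<le> 2 * (real n * exp (- (2 * \<delta>\<^sup>2) * real n))" for n
  proof (cases "n > 1")
    case True
    have "prob (B n) \<le> (\<Sum>v\<in>{1..n}. prob (D n v))"
      unfolding B_def using True D by (auto intro!: finite_measure_subadditive_finite)
    also have "\<dots> \<le> (\<Sum>v\<in>{1..n}. 2 * exp (- (2 * \<delta>\<^sup>2) * real n))"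
      using D True by (intro sum_mono) auto
    finally show ?thesis by simp
  qed (simp add: B_def)
  then have "summable (\<lambda>n. prob (B n))"
    using d by (intro summable_comparison_test[OF _ summable_mult[OF summable_of_nat_mult_exp[of "2 * \<delta>\<^sup>2"]]])
      auto
  \<comment> \<open>The convergence half of Borel-Cantelli uses only the individual probabilities,
    so the graphs for different \<open>n\<close> may be coupled in any way.\<close>
  then have "AE \<omega> in M. \<forall>\<^sub>F n in sequentially. \<omega> \<in> space M - B n"
    by (intro borel_cantelli_AE1 B) (simp_all add: emeasure_eq_measure)
  then show ?thesis
  proof eventually_elim
    case (elim \<omega>)
    \<comment> \<open>The bound 2 makes \<open>B n\<close> the union of the events
      \<open>D n v\<close>; the other bound gives \<open>1 \<le> \<delta> * n\<close>.\<close>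
    have "\<forall>\<^sub>F n in sequentially. n \<ge> max 2 (nat \<lceil>1 / \<delta>\<rceil>)" by (rule eventually_ge_at_top)
    with elim show ?case
    proof eventually_elim
      case (elim n)
      show ?case
      proof
        fix v assume v: "v \<in> {1..n}"
        let ?d = "real (card {w\<in>{1..n}. {v, w} \<in> G n \<omega>})"
        have "\<omega> \<notin> D n v" "\<omega> \<in> space M" using elim v by (auto simp: B_def)
        then have "\<bar>?d - (real n - 1) * p\<bar> < \<delta> * real n" by (auto simp: D_def)
        moreover have "1 \<le> \<delta> * real n"
        proof -
          have "1 / \<delta> \<le> real n" using elim by linarith
          then show ?thesis using d by (simp add: field_simps)
        qed
        moreover have "(real n - 1) * p = real n * p - p" "\<epsilon> * real n = 2 * (\<delta> * real n)"
          by (simp_all add: algebra_simps \<delta>_def)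
        ultimately show "\<bar>?d - real n * p\<bar> \<le> \<epsilon> * real n" using p by linarith
      qed
    qed
  qed
qed

text \<open>One null set has to serve all \<epsilon>, so the countably many values
  \<open>1 / (m + 1)\<close> are treated first.\<close>

lemma degrees_concentrate:
  fixes G :: "nat \<Rightarrow> 'w \<Rightarrow> nat set set"
  assumes er: "\<And>n. erdos_renyi M p {1..n} (G n)" and p: "0 \<le> p" "p \<le> 1"
  shows "AE \<omega> in M. \<forall>\<epsilon>>0. \<forall>\<^sub>F n in sequentially.
    \<forall>v\<in>{1..n}. \<bar>real (card {w\<in>{1..n}. {v, w} \<in> G n \<omega>}) - real n * p\<bar> \<le> \<epsilon> * real n"
proof -
  have "AE \<omega> in M. \<forall>m. \<forall>\<^sub>F n in sequentially. \<forall>v\<in>{1..n}.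
      \<bar>real (card {w\<in>{1..n}. {v, w} \<in> G n \<omega>}) - real n * p\<bar> \<le> inverse (real (Suc m)) * real n"
    unfolding AE_all_countable using degrees_concentrate_eps[OF er p] by simp
  then show ?thesis
  proof eventually_elim
    case (elim \<omega>)
    show ?case
    proof (intro allI impI)
      fix \<epsilon> :: real assume "\<epsilon> > 0"
      then obtain m where m: "inverse (real (Suc m)) < \<epsilon>" using reals_Archimedean by blast
      from elim have "\<forall>\<^sub>F n in sequentially. \<forall>v\<in>{1..n}.
          \<bar>real (card {w\<in>{1..n}. {v, w} \<in> G n \<omega>}) - real n * p\<bar> \<le> inverse (real (Suc m)) * real n" by blast
      then show "\<forall>\<^sub>F n in sequentially. \<forall>v\<in>{1..n}.
          \<bar>real (card {w\<in>{1..n}. {v, w} \<in> G n \<omega>}) - real n * p\<bar> \<le> \<epsilon> * real n"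
      proof eventually_elim
        case (elim n)
        have "inverse (real (Suc m)) * real n \<le> \<epsilon> * real n" using m by (intro mult_right_mono) auto
        with elim show ?case by (meson order_trans)
      qed
    qed
  qed
qed

section \<open>Moments of the root distribution\<close>

text \<open>The step function is the distribution function of \<open>y\<close> at a uniformly chosen
  index, and a distribution function determines its measure.\<close>

lemma interval_measure_discrete:
  fixes y :: "nat \<Rightarrow> real"
  assumes "n > 0"
  shows "(\<integral>x. x ^ k \<partial>interval_measure (\<lambda>x. real (card {i. i < n \<and> y i \<le> x}) / real n))
    = (\<Sum>i<n. y i ^ k) / real n"
proof -
  let ?D = "pmf_of_set {..<n}"
  define N where "N = distr (measure_pmf ?D) borel y"
  have ne: "{..<n} \<noteq> {}" using assms by auto
  interpret N: real_distribution N
    by (auto simp: N_def real_distribution_def real_distribution_axioms_def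
        intro!: measure_pmf.prob_space_distr)
  have cdf: "cdf N = (\<lambda>x. real (card {i. i < n \<and> y i \<le> x}) / real n)"
  proof
    fix x
    have "cdf N x = measure (measure_pmf ?D) {i. y i \<le> x}"
      by (simp add: cdf_def2 N_def measure_distr vimage_def)
    also have "\<dots> = real (card ({..<n} \<inter> {i. y i \<le> x})) / real n"
      using ne by (simp add: measure_pmf_of_set)
    also have "{..<n} \<inter> {i. y i \<le> x} = {i. i < n \<and> y i \<le> x}" by auto
    finally show "cdf N x = real (card {i. i < n \<and> y i \<le> x}) / real n" .
  qed
  have "interval_measure (cdf N) = N"
    by (intro cdf_unique real_distribution_interval_measure cdf_interval_measure
        N.real_distribution_axioms N.cdf_nondecreasing N.cdf_is_right_cont
        N.cdf_lim_at_top_prob N.cdf_lim_at_bot)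
  then have "(\<integral>x. x ^ k \<partial>interval_measure (\<lambda>x. real (card {i. i < n \<and> y i \<le> x}) / real n))
    = (\<integral>x. x ^ k \<partial>N)" by (simp only: cdf)
  also have "\<dots> = (\<integral>i. y i ^ k \<partial>measure_pmf ?D)"
    unfolding N_def by (rule integral_distr) auto
  also have "\<dots> = (\<Sum>i<n. y i ^ k) / real n"
    using ne by (simp add: integral_pmf_of_set)
  finally show ?thesis .
qed

section \<open>Coefficients of \<open>walk_fun\<close> against Catalan numbers\<close>

context simple_graph
begin

lemma walk_fun_nth_0:
  assumes "finite V" "v \<in> V"
  shows "fps_nth (walk_fun V v) 0 = 1"
  by (subst walk_fun_rec[OF assms]) (simp add: fps_mult_nth power2_eq_square)

lemma walk_fun_nth_1:
  assumes "finite V" "v \<in> V"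
  shows "fps_nth (walk_fun V v) (Suc 0) = 0"
  by (subst walk_fun_rec[OF assms]) (simp add: mult.assoc power2_eq_square)

lemma walk_fun_nth_Suc_Suc:
  assumes "finite V" "v \<in> V"
  shows "fps_nth (walk_fun V v) (Suc (Suc k)) = (\<Sum>i\<le>k.
    (\<Sum>w\<in>nbrs V v. fps_nth (walk_fun (V - {v}) w) i) * fps_nth (walk_fun V v) (k - i))"
proof -
  have "fps_nth (walk_fun V v) (Suc (Suc k)) =
      fps_nth ((\<Sum>w\<in>nbrs V v. walk_fun (V - {v}) w) * walk_fun V v) k"
    by (subst walk_fun_rec[OF assms]) (simp add: mult.assoc power2_eq_square)
  then show ?thesis by (simp only: fps_mult_nth fps_sum_nth atLeast0AtMost)
qed

text \<open>In the convolution the two indices add up to an odd number, so one of them is odd and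
  its factor vanishes by induction.\<close>

lemma walk_fun_nth_odd:
  assumes "finite V" "v \<in> V" "odd k"
  shows "fps_nth (walk_fun V v) k = 0"
  using assms
proof (induction k arbitrary: V v rule: less_induct)
  case (less k)
  show ?case
  proof (cases "k = 1")
    case True
    then show ?thesis using walk_fun_nth_1[OF less.prems(1,2)] by simp
  next
    case False
    with \<open>odd k\<close> obtain m where k: "k = Suc (Suc m)" "odd m"
      by (metis One_nat_def even_Suc not0_implies_Suc even_zero)
    have "(\<Sum>w\<in>nbrs V v. fps_nth (walk_fun (V - {v}) w) i) * fps_nth (walk_fun V v) (m - i) = 0"
      if "i \<le> m" for i
    proof (cases "odd i")
      case True
      have "fps_nth (walk_fun (V - {v}) w) i = 0" if "w \<in> nbrs V v" for w
        using that nbrs_irrefl[of v V] less.prems \<open>i \<le> m\<close> True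
        by (intro less.IH) (auto simp: k nbrs_def)
      then show ?thesis by simp
    next
      case False
      then have "fps_nth (walk_fun V v) (m - i) = 0"
        using less.prems k that by (intro less.IH) auto
      then show ?thesis by simp
    qed
    then show ?thesis
      unfolding k(1) walk_fun_nth_Suc_Suc[OF less.prems(1,2)] by (intro sum.neutral) simp
  qed
qed

lemma walk_fun_nth_even:
  assumes "finite V" "v \<in> V"
  shows "fps_nth (walk_fun V v) (2 * Suc k) = (\<Sum>i\<le>k.
    (\<Sum>w\<in>nbrs V v. fps_nth (walk_fun (V - {v}) w) (2 * i)) * fps_nth (walk_fun V v) (2 * (k - i)))"
proof -
  have even_sum: "(\<Sum>i\<le>2 * k. h i) = (\<Sum>i\<le>k. h (2 * i))"
    if "\<And>i. odd i \<Longrightarrow> h i = 0" for h :: "nat \<Rightarrow> real"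
    using that by (induction k) simp_all
  have odd_0: "(\<Sum>w\<in>nbrs V v. fps_nth (walk_fun (V - {v}) w) i) = 0" if "odd i" for i
    using nbrs_irrefl[of v V] assms that
    by (intro sum.neutral ballI walk_fun_nth_odd) (auto simp: nbrs_def)
  have "fps_nth (walk_fun V v) (2 * Suc k) = (\<Sum>i\<le>2 * k.
    (\<Sum>w\<in>nbrs V v. fps_nth (walk_fun (V - {v}) w) i) * fps_nth (walk_fun V v) (2 * k - i))"
    using walk_fun_nth_Suc_Suc[OF assms, of "2 * k"] by simp
  also have "\<dots> = (\<Sum>i\<le>k. (\<Sum>w\<in>nbrs V v. fps_nth (walk_fun (V - {v}) w) (2 * i)) *
      fps_nth (walk_fun V v) (2 * k - 2 * i))"
    by (rule even_sum) (simp add: odd_0)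
  finally show ?thesis by (simp add: diff_mult_distrib2)
qed

text \<open>Each step of the recursion for the coefficients of \<^term>\<open>walk_fun\<close> deletes a vertex, which lowers
  degrees by at most one, so \<^term>\<open>K\<close> is the number of vertices that may still be deleted.\<close>

lemma walk_fun_nth_bounds:
  assumes "finite V" "v \<in> V" "k \<le> K" "0 \<le> a"
    and deg: "\<And>u. u \<in> V \<Longrightarrow> a + real K \<le> real (card (nbrs V u)) \<and> real (card (nbrs V u)) \<le> b"
  shows "a ^ k * catalan k \<le> fps_nth (walk_fun V v) (2 * k) \<and>
    fps_nth (walk_fun V v) (2 * k) \<le> b ^ k * catalan k"
  using assms
proof (induction k arbitrary: V v K rule: less_induct)
  case (less k)
  note fin = less.prems(1) and v = less.prems(2) and deg = less.prems(5)
  show ?case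
  proof (cases k)
    case 0
    then show ?thesis using walk_fun_nth_0[OF fin v] by simp
  next
    case (Suc m)
    then obtain L where L: "K = Suc L" "m \<le> L" using less.prems(3) by (cases K) auto
    define s where "s = (\<lambda>i. \<Sum>w\<in>nbrs V v. fps_nth (walk_fun (V - {v}) w) (2 * i))"
    define f where "f = (\<lambda>i. fps_nth (walk_fun V v) (2 * i))"
    have b: "0 \<le> b" using deg[OF v] by simp
    have d: "a \<le> real (card (nbrs V v))" "real (card (nbrs V v)) \<le> b" using deg[OF v] by simp_all
    \<comment> \<open>Same graph, smaller index: no vertex is deleted and \<open>K\<close> is
      kept.\<close>
    have f: "a ^ i * catalan i \<le> f i \<and> f i \<le> b ^ i * catalan i" if "i \<le> m" for i
      unfolding f_def using less.prems that Suc by (intro less.IH[of i V v K]) auto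
    have s: "a ^ Suc i * catalan i \<le> s i \<and> s i \<le> b ^ Suc i * catalan i" if "i \<le> m" for i
    proof -
      have w: "a ^ i * catalan i \<le> fps_nth (walk_fun (V - {v}) w) (2 * i) \<and>
          fps_nth (walk_fun (V - {v}) w) (2 * i) \<le> b ^ i * catalan i" if "w \<in> nbrs V v" for w
      \<comment> \<open>Here \<open>v\<close> is deleted, which uses up one unit of
        \<open>K\<close>; the index drops as well, so \<open>L = K - 1\<close> still
        suffices.\<close>
      proof (rule less.IH[of i _ _ L])
        show "w \<in> V - {v}" using that nbrs_irrefl[of v V] by (auto simp: nbrs_def)
        fix u assume u: "u \<in> V - {v}"
        have "nbrs (V - {v}) u = nbrs V u - {v}" by (auto simp: nbrs_def)
        then have "card (nbrs V u) \<le> Suc (card (nbrs (V - {v}) u))"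
          and "card (nbrs (V - {v}) u) \<le> card (nbrs V u)"
          using finite_nbrs[OF fin, of u] diff_card_le_card_Diff[of "{v}" "nbrs V u"]
          by (simp_all add: card_mono)
        then have "real (card (nbrs V u)) \<le> real (card (nbrs (V - {v}) u)) + 1"
          "real (card (nbrs (V - {v}) u)) \<le> real (card (nbrs V u))" by linarith+
        then show "a + real L \<le> real (card (nbrs (V - {v}) u)) \<and> real (card (nbrs (V - {v}) u)) \<le> b"
          using deg[of u] u L(1) by simp
      qed (use fin \<open>i \<le> m\<close> Suc L(2) less.prems(4) in auto)
      have "a ^ Suc i * catalan i = a * (a ^ i * catalan i)" by simp
      also have "\<dots> \<le> real (card (nbrs V v)) * (a ^ i * catalan i)"
        using d less.prems(4) by (intro mult_right_mono) (auto simp: catalan_nonneg)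
      also have "\<dots> \<le> s i"
        unfolding s_def by (rule sum_bounded_below) (use w in auto)
      finally have lower: "a ^ Suc i * catalan i \<le> s i" .
      have "s i \<le> real (card (nbrs V v)) * (b ^ i * catalan i)"
        unfolding s_def by (rule sum_bounded_above) (use w in auto)
      also have "\<dots> \<le> b * (b ^ i * catalan i)"
        using d b by (intro mult_right_mono) (auto simp: catalan_nonneg)
      finally show ?thesis using lower by (simp add: mult.assoc)
    qed
    have nn: "0 \<le> a ^ i * catalan j" "0 \<le> b ^ i * catalan j" for i j
      using less.prems(4) b by (auto simp: catalan_nonneg)
    have rec: "fps_nth (walk_fun V v) (2 * k) = (\<Sum>i\<le>m. s i * f (m - i))"
      unfolding Suc walk_fun_nth_even[OF fin v] s_def f_def ..
    have cat: "c ^ k * catalan k = (\<Sum>i\<le>m. (c ^ Suc i * catalan i) * (c ^ (m - i) * catalan (m - i)))" for c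
      unfolding Suc catalan.simps sum_distrib_left
    proof (rule sum.cong[OF refl])
      fix i assume "i \<in> {..m}"
      then have "c ^ Suc m = c ^ Suc i * c ^ (m - i)" by (simp flip: power_add)
      then show "c ^ Suc m * (catalan i * catalan (m - i)) =
          (c ^ Suc i * catalan i) * (c ^ (m - i) * catalan (m - i))" by (simp only: mult_ac)
    qed
    have "a ^ k * catalan k \<le> (\<Sum>i\<le>m. s i * f (m - i))"
      unfolding cat
    proof (intro sum_mono mult_mono)
      fix i assume i: "i \<in> {..m}"
      show "a ^ Suc i * catalan i \<le> s i" using s i by simp
      show "a ^ (m - i) * catalan (m - i) \<le> f (m - i)" using f i by simp
      show "0 \<le> s i" using s[of i] nn(1)[of "Suc i" i] i by simp
    qed (rule nn)
    moreover have "(\<Sum>i\<le>m. s i * f (m - i)) \<le> b ^ k * catalan k"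
      unfolding cat
    proof (intro sum_mono mult_mono)
      fix i assume i: "i \<in> {..m}"
      show "s i \<le> b ^ Suc i * catalan i" using s i by simp
      show "f (m - i) \<le> b ^ (m - i) * catalan (m - i)" using f i by simp
      show "0 \<le> f (m - i)" using f[of "m - i"] nn(1)[of "m - i" "m - i"] i by simp
    qed (rule nn)
    ultimately show ?thesis unfolding rec ..
  qed
qed

end

text \<open>The list of roots is a permutation of the linear factors' roots, so it has length
  \<open>n\<close> and every index used by \<open>matching_edf\<close> is in range; its power sums
  are those of \<open>power_sum_roots\<close>.\<close>

lemma integral_matching_edf:
  assumes "n > 0" "E \<subseteq> all_edges {1..n}"
  shows "(\<integral>x. x ^ k \<partial>interval_measure (matching_edf p {1..n} E)) =
    (\<Sum>v\<in>{1..n}. fps_nth (simple_graph.walk_fun E {1..n} v) k) / (real n * sqrt (real n * p) ^ k)"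
proof -
  interpret simple_graph E
    using assms(2) by unfold_locales (auto simp: all_edges_def)
  obtain xs :: "real list" where xs: "length xs = card {1..n}"
    "matching_sum (-1) [:0, 1:] {1..n} = (\<Prod>x\<leftarrow>xs. [:-x, 1:])"
    using matching_sum_linear_factors[of "{1..n}"] by auto
  define ys where "ys = matching_roots {1..n} E"
  have "mset ys = mset xs"
    unfolding ys_def matching_roots_def matching_poly_eq[OF finite_atLeastAtMost assms(2)] xs(2)
      proots_linear_factors by simp
  then have len: "length ys = n" and sum_ys: "(\<Sum>x\<leftarrow>ys. x ^ k) = (\<Sum>x\<leftarrow>xs. x ^ k)"
    using xs(1) by (auto dest: mset_eq_length simp flip: sum_mset_sum_list)
  have "matching_edf p {1..n} E =
      (\<lambda>x. real (card {i. i < n \<and> ys ! i / sqrt (real n * p) \<le> x}) / real n)"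
    by (simp add: fun_eq_iff matching_edf_def ys_def)
  then have "(\<integral>x. x ^ k \<partial>interval_measure (matching_edf p {1..n} E)) =
      (\<Sum>i<n. (ys ! i / sqrt (real n * p)) ^ k) / real n"
    by (simp only: interval_measure_discrete[OF assms(1)])
  also have "(\<Sum>i<n. (ys ! i / sqrt (real n * p)) ^ k) = (\<Sum>x\<leftarrow>ys. x ^ k) / sqrt (real n * p) ^ k"
    by (simp add: power_divide sum_divide_distrib sum_list_sum_nth len atLeast0LessThan)
  also have "(\<Sum>x\<leftarrow>ys. x ^ k) = (\<Sum>v\<in>{1..n}. fps_nth (walk_fun {1..n} v) k)"
    unfolding sum_ys by (rule power_sum_roots[OF _ xs]) simp
  finally show ?thesis by (simp add: mult.commute)
qed

text \<open>The moment is an average over the vertices of normalised coefficients. The margin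
  \<open>m\<close> in the lower degree bound pays for the at most \<open>m\<close> vertex
  deletions.\<close>

lemma matching_moments_bounds:
  assumes "n > 0" "p > 0" "E \<subseteq> all_edges {1..n}" "0 \<le> a"
    and deg: "\<And>v. v \<in> {1..n} \<Longrightarrow>
      a + real m \<le> real (card {w\<in>{1..n}. {v, w} \<in> E}) \<and> real (card {w\<in>{1..n}. {v, w} \<in> E}) \<le> b"
  defines "I \<equiv> (\<integral>x. x ^ (2 * m) \<partial>interval_measure (matching_edf p {1..n} E))"
  shows "(a / (real n * p)) ^ m * catalan m \<le> I" "I \<le> (b / (real n * p)) ^ m * catalan m"
proof -
  interpret simple_graph E
    using assms(3) by unfold_locales (auto simp: all_edges_def)
  have "sqrt (real n * p) ^ (2 * m) = (real n * p) ^ m"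
    using assms(2) by (simp add: power_mult)
  then have I: "I = (\<Sum>v\<in>{1..n}. fps_nth (walk_fun {1..n} v) (2 * m)) / (real n * (real n * p) ^ m)"
    unfolding I_def integral_matching_edf[OF assms(1,3)] by simp
  have w: "a ^ m * catalan m \<le> fps_nth (walk_fun {1..n} v) (2 * m) \<and>
      fps_nth (walk_fun {1..n} v) (2 * m) \<le> b ^ m * catalan m" if "v \<in> {1..n}" for v
    using deg that assms(4) by (intro walk_fun_nth_bounds[where K = m]) (auto simp: nbrs_def)
  have pos: "0 < (real n * p) ^ m" "0 < real n" using assms(1,2) by simp_all
  have scale: "(c / (real n * p)) ^ m * catalan m =
      real n * (c ^ m * catalan m) / (real n * (real n * p) ^ m)" for c
    using pos by (simp add: power_divide)
  have "real (card {1..n}) * (a ^ m * catalan m) \<le> (\<Sum>v\<in>{1..n}. fps_nth (walk_fun {1..n} v) (2 * m))"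
    by (rule sum_bounded_below) (use w in auto)
  then show "(a / (real n * p)) ^ m * catalan m \<le> I"
    unfolding I scale using pos by (intro divide_right_mono) simp_all
  have "(\<Sum>v\<in>{1..n}. fps_nth (walk_fun {1..n} v) (2 * m)) \<le> real (card {1..n}) * (b ^ m * catalan m)"
    by (rule sum_bounded_above) (use w in auto)
  then show "I \<le> (b / (real n * p)) ^ m * catalan m"
    unfolding I scale using pos by (intro divide_right_mono) simp_all
qed

lemma matching_moments_odd:
  fixes E :: "nat set set"
  assumes "n > 0" "E \<subseteq> all_edges {1..n}" "odd k"
  shows "(\<integral>x. x ^ k \<partial>interval_measure (matching_edf p {1..n} E)) = 0"
proof -
  interpret simple_graph E
    using assms(2) by unfold_locales (auto simp: all_edges_def)
  show ?thesis
    unfolding integral_matching_edf[OF assms(1,2)] using walk_fun_nth_odd assms(3) by simp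
qed

lemma matching_moments_tendsto:
  fixes E :: "nat \<Rightarrow> nat set set"
  assumes "p > 0" and E: "\<And>n. E n \<subseteq> all_edges {1..n}"
    and deg: "\<And>\<epsilon>. \<epsilon> > 0 \<Longrightarrow> \<forall>\<^sub>F n in sequentially.
      \<forall>v\<in>{1..n}. \<bar>real (card {w\<in>{1..n}. {v, w} \<in> E n}) - real n * p\<bar> \<le> \<epsilon> * real n"
  shows "(\<lambda>n. \<integral>x. x ^ k \<partial>interval_measure (matching_edf p {1..n} (E n))) \<longlonglongrightarrow> semicircle_moment k"
proof (cases "odd k")
  case True
  have "\<forall>\<^sub>F n in sequentially. (\<integral>x. x ^ k \<partial>interval_measure (matching_edf p {1..n} (E n))) = 0"
    using eventually_gt_at_top[of 0] by eventually_elim (rule matching_moments_odd[OF _ E True])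
  then show ?thesis using semicircle_moment_odd[OF True] tendsto_eventually by metis
next
  case False
  then obtain m where k: "k = 2 * m" by (auto elim: evenE)
  let ?I = "\<lambda>n. \<integral>x. x ^ k \<partial>interval_measure (matching_edf p {1..n} (E n))"
  let ?D = "\<lambda>n v. \<bar>real (card {w\<in>{1..n}. {v, w} \<in> E n}) - real n * p\<bar>"
  \<comment> \<open>The largest degree deviation relative to \<open>n\<close>: a single null
    sequence in place of the quantified \<epsilon>, to which limit rules apply.\<close>
  define \<delta> where "\<delta> n = Max (?D n ` {1..n}) / real n" for n
  have \<delta>: "?D n v \<le> \<delta> n * real n" if "v \<in> {1..n}" for n v
  proof -
    have "?D n v \<le> Max (?D n ` {1..n})" using that by (intro Max_ge) auto
    then show ?thesis using that by (simp add: \<delta>_def)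
  qed
  have \<delta>_0: "\<delta> \<longlonglongrightarrow> 0"
  proof (rule LIMSEQ_I)
    fix r :: real assume "r > 0"
    then have "\<forall>\<^sub>F n in sequentially. \<forall>v\<in>{1..n}. ?D n v \<le> r / 2 * real n" by (intro deg) simp
    then have "\<forall>\<^sub>F n in sequentially. norm (\<delta> n - 0) < r"
      using eventually_gt_at_top[of 0]
    proof eventually_elim
      case (elim n)
      have "Max (?D n ` {1..n}) \<le> r / 2 * real n" using elim by (subst Max_le_iff) auto
      then have "\<delta> n \<le> r / 2" using elim(2) by (simp add: \<delta>_def pos_divide_le_eq)
      moreover have "0 \<le> \<delta> n * real n" using \<delta>[of 1 n] elim(2) by simp
      then have "0 \<le> \<delta> n" using elim(2) by (simp add: zero_le_mult_iff)
      ultimately show ?case using \<open>r > 0\<close> by simp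
    qed
    then show "\<exists>no. \<forall>n\<ge>no. norm (\<delta> n - 0) < r" by (simp add: eventually_sequentially)
  qed
  let ?a = "\<lambda>n. real n * p - \<delta> n * real n - real m" and ?b = "\<lambda>n. real n * p + \<delta> n * real n"
  let ?L = "\<lambda>n. 1 - \<delta> n / p - real m / p / real n" and ?U = "\<lambda>n. 1 + \<delta> n / p"
  have LU: "?a n / (real n * p) = ?L n" "?b n / (real n * p) = ?U n" if "n > 0" for n
    using that \<open>p > 0\<close> by (simp_all add: field_simps)
  have "?L \<longlonglongrightarrow> 1 - 0 / p - 0"
    using \<open>p > 0\<close> by (intro tendsto_intros \<delta>_0 lim_const_over_n) auto
  then have L: "?L \<longlonglongrightarrow> 1" by simp
  have "?U \<longlonglongrightarrow> 1 + 0 / p" using \<open>p > 0\<close> by (intro tendsto_intros \<delta>_0) auto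
  then have U: "?U \<longlonglongrightarrow> 1" by simp
  \<comment> \<open>Positivity of \<open>?L n\<close> makes the lower degree bound
    \<open>?a n\<close> nonnegative, as \<open>matching_moments_bounds\<close> requires.\<close>
  have ev: "\<forall>\<^sub>F n in sequentially. n > 0 \<and> ?L n > 0"
    using eventually_gt_at_top[of 0] order_tendstoD(1)[OF L zero_less_one] by eventually_elim simp
  have bounds: "?L n ^ m * catalan m \<le> ?I n" "?I n \<le> ?U n ^ m * catalan m" if n: "n > 0 \<and> ?L n > 0" for n
  proof -
    have np: "0 < real n * p" using n \<open>p > 0\<close> by simp
    have "0 < ?a n / (real n * p)" unfolding LU(1)[OF conjunct1[OF n]] using n by blast
    then have "0 * (real n * p) < ?a n" by (simp only: pos_less_divide_eq[OF np])
    then have a: "0 \<le> ?a n" by simp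
    have d: "?a n + real m \<le> real (card {w\<in>{1..n}. {v, w} \<in> E n}) \<and>
        real (card {w\<in>{1..n}. {v, w} \<in> E n}) \<le> ?b n" if "v \<in> {1..n}" for v
      using \<delta>[OF that] by linarith
    show "?L n ^ m * catalan m \<le> ?I n" "?I n \<le> ?U n ^ m * catalan m"
      using matching_moments_bounds[OF _ \<open>p > 0\<close> E[of n] a d] LU[of n] n unfolding k by simp_all
  qed
  have "?I \<longlonglongrightarrow> 1 ^ m * catalan m"
  proof (rule tendsto_sandwich)
    show "\<forall>\<^sub>F n in sequentially. ?L n ^ m * catalan m \<le> ?I n"
      using ev by eventually_elim (rule bounds(1))
    show "\<forall>\<^sub>F n in sequentially. ?I n \<le> ?U n ^ m * catalan m"
      using ev by eventually_elim (rule bounds(2))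
    show "(\<lambda>n. ?L n ^ m * catalan m) \<longlonglongrightarrow> 1 ^ m * catalan m" by (intro tendsto_intros L)
    show "(\<lambda>n. ?U n ^ m * catalan m) \<longlonglongrightarrow> 1 ^ m * catalan m" by (intro tendsto_intros U)
  qed
  then show ?thesis by (simp add: k semicircle_moment_even)
qed

theorem theorem3p4:
  fixes M :: "'w measure" and p :: real and G :: "nat \<Rightarrow> 'w \<Rightarrow> nat set set" and k :: nat
  assumes "0 < p" and "p < 1"
    and "prob_space M"
    and "\<And>n. erdos_renyi M p {1..n} (G n)"
    and "k > 0"
  shows "AE \<omega> in M.
    (\<lambda>n. \<integral>x. x ^ k \<partial>interval_measure (matching_edf p {1..n} (G n \<omega>)))
      \<longlonglongrightarrow> (\<integral>x. x ^ k \<partial>semicircle_distribution)"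
proof -
  have "AE \<omega> in M. \<forall>\<epsilon>>0. \<forall>\<^sub>F n in sequentially.
      \<forall>v\<in>{1..n}. \<bar>real (card {w\<in>{1..n}. {v, w} \<in> G n \<omega>}) - real n * p\<bar> \<le> \<epsilon> * real n"
    using assms by (intro degrees_concentrate) auto
  then show ?thesis
    using AE_space
  proof eventually_elim
    case (elim \<omega>)
    have "G n \<omega> \<subseteq> all_edges {1..n}" for n
      using assms(4)[of n] elim(2) unfolding erdos_renyi_def by blast
    with elim(1) show ?case
      unfolding integral_semicircle_distribution
      by (intro matching_moments_tendsto[OF assms(1)]) auto
  qed
qed

end
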